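(* For every non-negative integer $k$, if $l=1$ then $S(k,l)=\binom{k+l}{l}=k+1$; that is, $S(k,1)=k+1$.
   Context: A 0-1 matrix $N$ with $a$ rows and $b$ columns can be found in a collection of sets $\mathcal{H}$ if there are distinct sets $H_1,\dots,H_a\in\mathcal{H}$ and distinct elements $e_1,\dots,e_b\in\bigcup_{H\in\mathcal{H}}H$ such that $N_{\alpha,\beta}=1$ if and only if $e_\beta\in H_\alpha$. For an integer $n\ge 1$, the following matrices have $n+1$ rows and $n$ columns with entries in $\{0,1\}$: the $n$-singleton matrix $S^n$, with $S^n_{i,j}=1$ iff $i=j+1$; the $n$-cosingleton matrix $\bar S^n$, with $\bar S^n_{i,j}=0$ iff $i=j$; the $n$-monotone matrix $M^n$, with $M^n_{i,j}=1$ iff $i\ge j+1$. For non-negative integers $k,l$, $S(k,l)$ is the smallest non-negative integer $S$ such that for every collection of distinct sets $\mathcal{H}$ with $|\mathcal{H}|>S$, at least one of $S^{k+1}$, $\bar S^{l+1}$, $M^{\min(k+1,l+1)}$ can be found in $\mathcal{H}$ (such an integer exists). *)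

theory Defs
  imports Main "Jordan_Normal_Form.Matrix"
begin

text \<open>Matrix indices start at 0. The conditions relating a row index to a column index in the
  three matrices below are invariant under shifting both indices by one, so they read exactly as
  with indices starting at 1.\<close>

definition singleton_mat :: "nat \<Rightarrow> nat mat" where
  "singleton_mat n = mat (n + 1) n (\<lambda>(i, j). if i = j + 1 then 1 else 0)"

definition cosingleton_mat :: "nat \<Rightarrow> nat mat" where
  "cosingleton_mat n = mat (n + 1) n (\<lambda>(i, j). if i = j then 0 else 1)"

definition monotone_mat :: "nat \<Rightarrow> nat mat" where
  "monotone_mat n = mat (n + 1) n (\<lambda>(i, j). if i \<ge> j + 1 then 1 else 0)"

definition found_in :: "nat mat \<Rightarrow> 'a set set \<Rightarrow> bool" where
  "found_in N \<H> \<longleftrightarrow>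
    (\<exists>(H :: nat \<Rightarrow> 'a set) (e :: nat \<Rightarrow> 'a).
      inj_on H {..<dim_row N} \<and> H ` {..<dim_row N} \<subseteq> \<H> \<and>
      inj_on e {..<dim_col N} \<and> e ` {..<dim_col N} \<subseteq> \<Union>\<H> \<and>
      (\<forall>\<alpha><dim_row N. \<forall>\<beta><dim_col N. N $$ (\<alpha>, \<beta>) = 1 \<longleftrightarrow> e \<beta> \<in> H \<alpha>))"

text \<open>The collections range over all sets of subsets of the type \<open>'a\<close>, which is meant to be
  infinite: over a finite type there may be too few sets for the number to have its intended
  value. Infinite collections count as having more than \<open>S\<close> members; they need a separate
  disjunct because \<^const>\<open>card\<close> is 0 on infinite sets.\<close>

definition S_number :: "'a itself \<Rightarrow> nat \<Rightarrow> nat \<Rightarrow> nat" where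
  "S_number (_ :: 'a itself) k l =
    (LEAST S. \<forall>\<H> :: 'a set set. (infinite \<H> \<or> card \<H> > S) \<longrightarrow>
      found_in (singleton_mat (k + 1)) \<H> \<or>
      found_in (cosingleton_mat (l + 1)) \<H> \<or>
      found_in (monotone_mat (min (k + 1) (l + 1))) \<H>)"

end

theory Submission
  imports Defs
begin

text \<open>Let \<open>C\<close> be the intersection of \<open>\<H>\<close>. If \<open>\<H>\<close> contains neither the 2-cosingleton nor the
  2-monotone matrix, and \<open>a \<in> X \<inter> A\<close>, \<open>b \<in> X - A\<close>, then no member of \<open>\<H>\<close> can avoid \<open>a\<close>; hence
  any two distinct members meet exactly in \<open>C\<close>, that is, \<open>\<H>\<close> is a sunflower with kernel \<open>C\<close>. At
  most one petal is empty, so \<open>k + 2\<close> members give the \<open>(k + 1)\<close>-singleton matrix. Conversely, the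
  empty set together with \<open>k\<close> singletons contains none of the three matrices.\<close>

lemma found_in_mono:
  assumes "found_in N \<F>" and "\<F> \<subseteq> \<H>"
  shows "found_in N \<H>"
proof -
  have "\<Union>\<F> \<subseteq> \<Union>\<H>"
    using assms(2) by blast
  with assms show ?thesis
    unfolding found_in_def by (meson order_trans)
qed

lemma found_in_card:
  assumes "found_in N \<H>" and "finite \<H>"
  shows "dim_row N \<le> card \<H>"
  using assms unfolding found_in_def by (metis card_inj_on_le card_lessThan finite_lessThan)

text \<open>The columns with a 1 in row \<open>\<alpha>\<close> give distinct elements of the set
  realizing that row. This excludes matrices with several ones in a row when all members are
  small.\<close>

lemma found_in_card_row:
  assumes "found_in N \<H>" and "\<alpha> < dim_row N" and "\<And>X. X \<in> \<H> \<Longrightarrow> finite X"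
  shows "\<exists>X\<in>\<H>. card {\<beta>. \<beta> < dim_col N \<and> N $$ (\<alpha>, \<beta>) = 1} \<le> card X"
proof -
  obtain H and e :: "nat \<Rightarrow> 'a" where H: "H ` {..<dim_row N} \<subseteq> \<H>"
    and e: "inj_on e {..<dim_col N}"
    and N: "\<forall>\<alpha><dim_row N. \<forall>\<beta><dim_col N. N $$ (\<alpha>, \<beta>) = 1 \<longleftrightarrow> e \<beta> \<in> H \<alpha>"
    using assms(1) unfolding found_in_def by blast
  have X: "H \<alpha> \<in> \<H>"
    using H assms(2) by blast
  have "card {\<beta>. \<beta> < dim_col N \<and> N $$ (\<alpha>, \<beta>) = 1} \<le> card (H \<alpha>)"
  proof (rule card_inj_on_le)
    show "inj_on e {\<beta>. \<beta> < dim_col N \<and> N $$ (\<alpha>, \<beta>) = 1}"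
      by (rule inj_on_subset[OF e]) auto
    show "e ` {\<beta>. \<beta> < dim_col N \<and> N $$ (\<alpha>, \<beta>) = 1} \<subseteq> H \<alpha>"
      using N assms(2) by auto
    show "finite (H \<alpha>)"
      using assms(3) X by blast
  qed
  with X show ?thesis by blast
qed

text \<open>On the columns \<open>a\<close>, \<open>b\<close> the rows \<open>A\<close>,
  \<open>B\<close>, \<open>X\<close> read 01, 10, 11.\<close>

lemma found_in_cosingleton_2:
  assumes "A \<in> \<H>" "B \<in> \<H>" "X \<in> \<H>"
    and "a \<notin> A" "b \<in> A" "a \<in> B" "b \<notin> B" "a \<in> X" "b \<in> X"
  shows "found_in (cosingleton_mat 2) \<H>"
proof -
  have "A \<noteq> B" "A \<noteq> X" "B \<noteq> X" "a \<noteq> b" "a \<in> \<Union>\<H>" "b \<in> \<Union>\<H>"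
    using assms by auto
  with assms show ?thesis
    unfolding found_in_def cosingleton_mat_def
    by (intro exI[of _ "(!) [A, B, X]"] exI[of _ "(!) [a, b]"])
      (auto simp: inj_on_def numeral_3_eq_3 numeral_2_eq_2 less_Suc_eq
        simp del: Union_iff del: UnionE UnionI)
qed

text \<open>The rows now read 00, 10, 11: only the entry of \<open>A\<close> at \<open>b\<close>
  differs from the cosingleton pattern, so the two lemmas together cover both cases for
  \<open>b\<close>.\<close>

lemma found_in_monotone_2:
  assumes "A \<in> \<H>" "B \<in> \<H>" "X \<in> \<H>"
    and "a \<notin> A" "b \<notin> A" "a \<in> B" "b \<notin> B" "a \<in> X" "b \<in> X"
  shows "found_in (monotone_mat 2) \<H>"
proof -
  have "A \<noteq> B" "A \<noteq> X" "B \<noteq> X" "a \<noteq> b" "a \<in> \<Union>\<H>" "b \<in> \<Union>\<H>"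
    using assms by auto
  with assms show ?thesis
    unfolding found_in_def monotone_mat_def
    by (intro exI[of _ "(!) [A, B, X]"] exI[of _ "(!) [a, b]"])
      (auto simp: inj_on_def numeral_3_eq_3 numeral_2_eq_2 less_Suc_eq
        simp del: Union_iff del: UnionE UnionI)
qed

lemma sunflower_if_not_found:
  assumes co: "\<not> found_in (cosingleton_mat 2) \<H>" and mono: "\<not> found_in (monotone_mat 2) \<H>"
    and A: "A \<in> \<H>" and B: "B \<in> \<H>" and "A \<noteq> B"
  shows "A \<inter> B = \<Inter>\<H>"
proof -
  \<comment> \<open>If \<open>Z\<close> misses some \<open>a\<close> in \<open>X \<inter> Y\<close>,
    take \<open>b\<close> in \<open>X - Y\<close>: the sets \<open>Z\<close>, \<open>Y\<close>,
    \<open>X\<close> form the cosingleton matrix when \<open>b\<close> lies in \<open>Z\<close>, and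
    the monotone matrix otherwise.\<close>
  have aux: "X \<inter> Y \<subseteq> Z" if "X \<in> \<H>" "Y \<in> \<H>" "Z \<in> \<H>" "X - Y \<noteq> {}" for X Y Z
    using that found_in_cosingleton_2[of Z \<H> Y X] found_in_monotone_2[of Z \<H> Y X] co mono
    by blast
  have "A \<inter> B \<subseteq> Z" if "Z \<in> \<H>" for Z
    \<comment> \<open>Distinct sets have a nonempty difference in at least one direction, so
      \<open>aux\<close> applies in one of the two orders.\<close>
    using aux[of A B Z] aux[of B A Z] A B that \<open>A \<noteq> B\<close> by blast
  with A B show ?thesis by blast
qed

text \<open>A point of a member outside the kernel lies in no other member. One such point from each
  of \<open>n\<close> members gives the columns, and the remaining member is the zero row.\<close>

lemma sunflower_found_in_singleton:
  assumes card: "card \<F> = n + 1"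
    and sunflower: "\<And>A B. A \<in> \<F> \<Longrightarrow> B \<in> \<F> \<Longrightarrow> A \<noteq> B \<Longrightarrow> A \<inter> B = C"
  shows "found_in (singleton_mat n) \<F>"
\<comment> \<open>A single member puts no constraint on \<open>C\<close>, which then need not be
  contained in it.\<close>
proof (cases "n = 0")
  case True
  then obtain X where "\<F> = {X}"
    using card by (metis add_0 card_1_singletonE)
  with True show ?thesis
    unfolding found_in_def singleton_mat_def
    by (intro exI[of _ "\<lambda>_. X"]) (auto simp: inj_on_def)
next
  case False
  have fin: "finite \<F>"
    using card by (simp add: card_ge_0_finite)
  have C: "C \<subseteq> X" if X: "X \<in> \<F>" for X
  proof -
    have "\<F> \<noteq> {X}"
      using card False by auto
    then obtain Y where "Y \<in> \<F>" "Y \<noteq> X"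
      using X by blast
    with X sunflower[of X Y] show ?thesis by blast
  qed
  \<comment> \<open>\<open>Z\<close> is reserved for the zero row. Taking the kernel itself whenever
    it is a member leaves only nonempty petals for the other rows.\<close>
  obtain Z where Z: "Z \<in> \<F>" "C \<in> \<F> \<Longrightarrow> Z = C"
    using card by (metis add_is_0 card.empty ex_in_conv one_neq_zero)
  have "card (\<F> - {Z}) = n"
    using card Z(1) by simp
  with fin obtain h where h: "bij_betw h {..<n} (\<F> - {Z})"
    by (metis bij_betw_iff_card card_lessThan finite_Diff finite_lessThan)
  have h_in: "h i \<in> \<F>" "h i \<noteq> Z" if "i < n" for i
    using bij_betwE[OF h] that by auto
  have "\<exists>x. x \<in> h i - C" if "i < n" for i
  proof -
    have "h i \<noteq> C" "C \<subseteq> h i"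
      using h_in[OF that] C Z(2) by metis+
    then show ?thesis by blast
  qed
  then obtain e where e: "\<And>i. i < n \<Longrightarrow> e i \<in> h i - C"
    by metis
  have unique: "X = h i" if "i < n" "X \<in> \<F>" "e i \<in> X" for i X
    using sunflower[OF that(2) h_in(1)[OF that(1)]] e[OF that(1)] that(3) by blast
  have inj_h: "i = j" if "h i = h j" "i < n" "j < n" for i j
    using h that by (auto simp: bij_betw_def inj_on_def)
  \<comment> \<open>Row 0 is \<open>Z\<close> and row \<open>i + 1\<close> is \<open>h i\<close>,
    matching the ones at \<open>i = j + 1\<close> in the singleton matrix.\<close>
  define H where "H = case_nat Z h"
  have "inj_on H {..<n + 1}"
    by (rule inj_onI)
      (auto simp: H_def h_in h_in(2)[symmetric] split: nat.splits dest: inj_h)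
  moreover have H_in: "H \<alpha> \<in> \<F>" if "\<alpha> < n + 1" for \<alpha>
    using that Z(1) h_in by (auto simp: H_def split: nat.splits)
  moreover have "inj_on e {..<n}"
  proof (rule inj_onI)
    fix i j assume ij: "i \<in> {..<n}" "j \<in> {..<n}" "e i = e j"
    then have "h j = h i"
      using unique[of i "h j"] h_in(1)[of j] e[of j] by auto
    then show "i = j"
      using ij inj_h by auto
  qed
  moreover have "e \<beta> \<in> \<Union>\<F>" if "\<beta> < n" for \<beta>
    using e h_in that by blast
  moreover have "e \<beta> \<in> H \<alpha> \<longleftrightarrow> \<alpha> = \<beta> + 1" if "\<alpha> < n + 1" "\<beta> < n" for \<alpha> \<beta>
  proof
    assume "e \<beta> \<in> H \<alpha>"
    then have "H \<alpha> = h \<beta>"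
      using unique H_in that by blast
    then show "\<alpha> = \<beta> + 1"
      using that h_in[of \<beta>] inj_h by (auto simp: H_def split: nat.splits)
  qed (use that e in \<open>auto simp: H_def\<close>)
  ultimately show ?thesis
    unfolding found_in_def singleton_mat_def
    by (intro exI[of _ H] exI[of _ e]) (simp add: image_subset_iff)
qed

lemma found_in_large_collection:
  assumes "infinite \<H> \<or> card \<H> > k + 1"
  shows "found_in (singleton_mat (k + 1)) \<H> \<or> found_in (cosingleton_mat 2) \<H> \<or>
    found_in (monotone_mat (min (k + 1) 2)) \<H>"
proof -
  obtain \<F> where \<F>: "\<F> \<subseteq> \<H>" "card \<F> = k + 1 + 1"
    using assms infinite_arbitrarily_large[of \<H> "k + 1 + 1"]
      obtain_subset_with_card_n[of "k + 1 + 1" \<H>]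
    by (metis Suc_eq_plus1 Suc_leI)
  show ?thesis
  \<comment> \<open>For \<open>k = 0\<close> the third matrix is \<open>monotone_mat 1\<close>, so
    \<open>monotone_mat 2\<close> cannot be assumed absent; but two distinct sets always form a
    sunflower around their intersection.\<close>
  proof (cases "k = 0")
    case True
    with \<F>(2) obtain A B where "\<F> = {A, B}" "A \<noteq> B"
      by (auto simp: card_Suc_eq)
    then have "found_in (singleton_mat (k + 1)) \<F>"
      using \<F>(2) by (intro sunflower_found_in_singleton[where C = "A \<inter> B"]) auto
    with \<F>(1) show ?thesis
      using found_in_mono by blast
  next
    case False
    then have "min (k + 1) 2 = 2"
      by simp
    with \<F> show ?thesis
      using sunflower_found_in_singleton[OF \<F>(2)] sunflower_if_not_found[of \<F>]
        found_in_mono[OF _ \<F>(1)]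
      by metis
  qed
qed

text \<open>The singleton matrix has \<open>k + 2\<close> rows, one more than there are members. The
  2-cosingleton and 2-monotone matrices have two ones in the last row, but no member has two
  elements.\<close>

lemma not_found_in_singletons:
  fixes V :: "'a set"
  assumes "finite V" "card V = k"
  defines "\<H> \<equiv> insert {} ((\<lambda>x. {x}) ` V)"
  shows "card \<H> = k + 1"
    and "\<not> found_in (singleton_mat (k + 1)) \<H>"
    and "\<not> found_in (cosingleton_mat 2) \<H>"
    and "\<not> found_in (monotone_mat (min (k + 1) 2)) \<H>"
proof -
  have fin: "finite \<H>" and card_mem: "\<And>X. X \<in> \<H> \<Longrightarrow> finite X \<and> card X \<le> 1"
    using assms by (auto simp: \<H>_def)
  show card: "card \<H> = k + 1"
    using assms by (auto simp: \<H>_def card_insert_if card_image)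
  show "\<not> found_in (singleton_mat (k + 1)) \<H>"
    using found_in_card[OF _ fin, of "singleton_mat (k + 1)"] card
    by (auto simp: singleton_mat_def)
  have no_two: "\<not> found_in N \<H>"
    if N: "dim_row N = 3" "dim_col N = 2" "\<And>\<beta>. \<beta> < 2 \<Longrightarrow> N $$ (2, \<beta>) = 1" for N
  proof
    have *: "{\<beta>. \<beta> < dim_col N \<and> N $$ (2, \<beta>) = 1} = {..<2}"
      using N by auto
    assume "found_in N \<H>"
    then obtain X where "X \<in> \<H>" "2 \<le> card X"
      using found_in_card_row[of N \<H> 2] N(1) card_mem unfolding * by auto
    with card_mem show False by force
  qed
  show "\<not> found_in (cosingleton_mat 2) \<H>"
    by (rule no_two) (auto simp: cosingleton_mat_def)
  show "\<not> found_in (monotone_mat (min (k + 1) 2)) \<H>"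
  \<comment> \<open>For \<open>k = 0\<close> the last row of \<open>monotone_mat 1\<close> has a
    single one, so rows are counted instead: two rows against one member.\<close>
  proof (cases "k = 0")
    case True
    then show ?thesis
      using found_in_card[OF _ fin, of "monotone_mat 1"] card
      by (auto simp: monotone_mat_def)
  next
    case False
    then have "min (k + 1) 2 = 2"
      by simp
    moreover have "\<not> found_in (monotone_mat 2) \<H>"
      by (rule no_two) (auto simp: monotone_mat_def)
    ultimately show ?thesis by metis
  qed
qed

theorem lemma3:
  fixes k l :: nat
  assumes "infinite (UNIV :: 'a set)"
    and "l = 1"
  shows "S_number TYPE('a) k l = (k + l) choose l \<and> (k + l) choose l = k + 1"
proof -
  have l: "l + 1 = 2"
    using assms(2) by simp
  have "S_number TYPE('a) k l = k + 1"
    unfolding S_number_def l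
  proof (rule Least_equality)
    show "\<forall>\<H> :: 'a set set. infinite \<H> \<or> card \<H> > k + 1 \<longrightarrow>
      found_in (singleton_mat (k + 1)) \<H> \<or> found_in (cosingleton_mat 2) \<H> \<or>
      found_in (monotone_mat (min (k + 1) 2)) \<H>"
      using found_in_large_collection by blast
  next
    fix S
    assume *: "\<forall>\<H> :: 'a set set. infinite \<H> \<or> card \<H> > S \<longrightarrow>
      found_in (singleton_mat (k + 1)) \<H> \<or> found_in (cosingleton_mat 2) \<H> \<or>
      found_in (monotone_mat (min (k + 1) 2)) \<H>"
    \<comment> \<open>Infinitude of the type supplies the \<open>k\<close> points; the resulting
      \<open>k + 1\<close> sets refute every \<open>S\<close> below \<open>k + 1\<close>.\<close>
    obtain V :: "'a set" where V: "finite V" "card V = k"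
      using infinite_arbitrarily_large[OF assms(1)] by blast
    show "k + 1 \<le> S"
      using * not_found_in_singletons[OF V] by (metis not_le)
  qed
  with assms(2) show ?thesis by simp
qed

end
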